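(* Let $k>0$ and $\epsilon>0$. Consider the continuous-time Markov chain $(X_t,C_t)$ on $\{1,2,3,4\}\times\{1,2\}$ in which vertex $3$ is absorbing and, from a state $(i,\alpha)$ with $i\neq3$, the position jumps at rate $k$ to the neighbour $j(i,\alpha)$ (with $\alpha$ unchanged), where $$j(1,1)=2,\quad j(2,1)=1,\quad j(4,1)=3,\quad j(1,2)=4,\quad j(4,2)=1,\quad j(2,2)=3,$$ and the channel switches $\alpha\to\bar\alpha$ (the other element of $\{1,2\}$, with $i$ unchanged) at rate $\epsilon$. Let $T_{i,\alpha}$ be the mean hitting time of vertex $3$ from $(i,\alpha)$. Then $$T_{1,1}=T_{1,2}=\frac4k+\frac2\epsilon,\qquad T_{2,1}=T_{4,2}=\frac3k+\frac2\epsilon,\qquad T_{4,1}=T_{2,2}=\frac3k .$$ In particular, for $\alpha\in\{1,2\}$, $\mathbb E_{1,\alpha}[\tau_3]=\frac4k+\frac2\epsilon\sim\frac2\epsilon$ as $\epsilon\downarrow0$.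
   Context: $\tau_3=\inf\{t\ge0:X_t=3\}$, and $T_{i,\alpha}=\mathbb E_{i,\alpha}[\tau_3]$ is its expectation for the chain started at $(i,\alpha)$. *)

theory Defs
  imports "HOL-Probability.Probability" "HOL-Library.Landau_Symbols"
begin

section \<open>Continuous-time Markov chains on a finite state space\<close>

text \<open>
  Matrices indexed by a finite set \<open>S\<close> are functions \<open>'s \<Rightarrow> 's \<Rightarrow> real\<close>; only entries in
  \<open>S \<times> S\<close> matter. A chain is specified by its off-diagonal jump rates \<open>r x y\<close>.
\<close>

definition generator :: "'s set \<Rightarrow> ('s \<Rightarrow> 's \<Rightarrow> real) \<Rightarrow> 's \<Rightarrow> 's \<Rightarrow> real" where
  "generator S r x y = (if x = y then - (\<Sum>z\<in>S - {x}. r x z) else r x y)"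

primrec matrix_power :: "'s set \<Rightarrow> ('s \<Rightarrow> 's \<Rightarrow> real) \<Rightarrow> nat \<Rightarrow> 's \<Rightarrow> 's \<Rightarrow> real" where
  "matrix_power S Q 0 = (\<lambda>x y. of_bool (x = y))"
| "matrix_power S Q (Suc n) = (\<lambda>x y. \<Sum>z\<in>S. Q x z * matrix_power S Q n z y)"

text \<open>The transition semigroup \<open>exp (t Q)\<close>, entrywise.\<close>

definition transition_prob :: "'s set \<Rightarrow> ('s \<Rightarrow> 's \<Rightarrow> real) \<Rightarrow> real \<Rightarrow> 's \<Rightarrow> 's \<Rightarrow> real" where
  "transition_prob S Q t x y = (\<Sum>n. t ^ n / fact n * matrix_power S Q n x y)"

text \<open>
  \<open>X\<close> is a continuous-time Markov chain on \<open>S\<close> with generator \<open>Q\<close>, started at \<open>s\<close>. The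
  right-continuity clause is stated for the discrete topology on \<open>S\<close>.
\<close>

definition ctmc_from ::
  "'w measure \<Rightarrow> 's set \<Rightarrow> ('s \<Rightarrow> 's \<Rightarrow> real) \<Rightarrow> 's \<Rightarrow> (real \<Rightarrow> 'w \<Rightarrow> 's) \<Rightarrow> bool" where
  "ctmc_from M S Q s X \<longleftrightarrow>
     prob_space M \<and>
     (\<forall>t\<ge>0. X t \<in> measurable M (count_space S)) \<and>
     (\<forall>\<omega>\<in>space M. \<forall>t\<ge>0. \<forall>\<^sub>F u in at_right t. X u \<omega> = X t \<omega>) \<and>
     \<P>(\<omega> in M. X 0 \<omega> = s) = 1 \<and>
     (\<forall>(n::nat) (t :: nat \<Rightarrow> real) (x :: nat \<Rightarrow> 's) u y.
        0 \<le> t 0 \<and> (\<forall>i<n. t i \<le> t (Suc i)) \<and> t n \<le> u \<and> (\<forall>i\<le>n. x i \<in> S) \<and> y \<in> S \<and>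
        \<P>(\<omega> in M. \<forall>i\<le>n. X (t i) \<omega> = x i) > 0 \<longrightarrow>
        \<P>(\<omega> in M. X u \<omega> = y \<bar> \<forall>i\<le>n. X (t i) \<omega> = x i)
          = transition_prob S Q (u - t n) (x n) y)"

text \<open>The infimum is taken in \<open>[0, \<infinity>]\<close>, so it is \<open>\<infinity>\<close> on paths that never visit \<open>A\<close>.\<close>

definition hitting_time :: "(real \<Rightarrow> 'w \<Rightarrow> 's) \<Rightarrow> 's set \<Rightarrow> 'w \<Rightarrow> ennreal" where
  "hitting_time X A \<omega> = Inf {ennreal t | t. 0 \<le> t \<and> X t \<omega> \<in> A}"

definition mean_hitting_time :: "'w measure \<Rightarrow> (real \<Rightarrow> 'w \<Rightarrow> 's) \<Rightarrow> 's set \<Rightarrow> ennreal" where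
  "mean_hitting_time M X A = (\<integral>\<^sup>+ \<omega>. hitting_time X A \<omega> \<partial>M)"


section \<open>The two-channel chain on four vertices\<close>

definition states :: "(nat \<times> nat) set" where
  "states = {1, 2, 3, 4} \<times> {1, 2}"

text \<open>The value \<open>neighbour 3 \<alpha>\<close> is junk; it is never used.\<close>

definition neighbour :: "nat \<Rightarrow> nat \<Rightarrow> nat" where
  "neighbour i \<alpha> =
     (if (i, \<alpha>) = (1, 1) then 2
      else if (i, \<alpha>) = (2, 1) then 1
      else if (i, \<alpha>) = (4, 1) then 3
      else if (i, \<alpha>) = (1, 2) then 4
      else if (i, \<alpha>) = (4, 2) then 1
      else if (i, \<alpha>) = (2, 2) then 3
      else i)"

text \<open>Both states over vertex \<open>3\<close> are absorbing: no jump and no switch leaves them.\<close>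

definition rate :: "real \<Rightarrow> real \<Rightarrow> nat \<times> nat \<Rightarrow> nat \<times> nat \<Rightarrow> real" where
  "rate k \<epsilon> = (\<lambda>(i, \<alpha>) (j, \<beta>).
     if i = 3 then 0
     else if \<beta> = \<alpha> \<and> j = neighbour i \<alpha> then k
     else if \<beta> \<noteq> \<alpha> \<and> j = i then \<epsilon>
     else 0)"

text \<open>For every starting state \<open>s\<close>, the pair \<open>(M s, X s)\<close> is a realization of the chain from \<open>s\<close>.\<close>

definition two_channel_chain ::
  "real \<Rightarrow> real \<Rightarrow> (nat \<times> nat \<Rightarrow> 'w measure) \<Rightarrow> (nat \<times> nat \<Rightarrow> real \<Rightarrow> 'w \<Rightarrow> nat \<times> nat) \<Rightarrow> bool"
where
  "two_channel_chain k \<epsilon> M X \<longleftrightarrow>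
     (\<forall>s\<in>states. ctmc_from (M s) states (generator states (rate k \<epsilon>)) s (X s))"

definition mean_time_to_3 ::
  "(nat \<times> nat \<Rightarrow> 'w measure) \<Rightarrow> (nat \<times> nat \<Rightarrow> real \<Rightarrow> 'w \<Rightarrow> nat \<times> nat) \<Rightarrow> nat \<Rightarrow> nat \<Rightarrow> ennreal"
where
  "mean_time_to_3 M X i \<alpha> = mean_hitting_time (M (i, \<alpha>)) (X (i, \<alpha>)) {x. fst x = 3}"

end

theory Submission
  imports Defs "HOL-Real_Asymp.Real_Asymp"
begin

text \<open>
  A nonnegative solution \<open>h\<close> of the Poisson equation \<open>Q h = -1\<close> off a closed set \<open>A\<close>, with \<open>h = 0\<close> on
  \<open>A\<close>, is the mean hitting time of \<open>A\<close>. Put \<open>g t = E (h (X t))\<close> and \<open>p t = P (X t \<notin> A)\<close>. The forward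
  equation gives \<open>g' = - p\<close>, and \<open>g \<le> C p\<close> then forces \<open>g\<close> to decay exponentially, so
  \<open>h s = g 0 = \<integral> p\<close>. Since \<open>A\<close> is closed and paths are right-continuous, almost surely
  \<open>X t \<notin> A\<close> exactly when the hitting time exceeds \<open>t\<close>, so \<open>\<integral> p\<close> is also its expectation.
  For the two-channel chain the claimed values solve the Poisson equation.
\<close>

section \<open>Matrix powers, the exponential series and its forward equation\<close>

lemma matrix_power_Suc_right:
  assumes "finite S" "x \<in> S" "y \<in> S"
  shows "matrix_power S Q (Suc n) x y = (\<Sum>z\<in>S. matrix_power S Q n x z * Q z y)"
  using assms(2)
proof (induction n arbitrary: x)
  case 0
  then show ?case using assms by (simp add: of_bool_def if_distrib if_distribR sum.delta cong: if_cong)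
next
  case (Suc n)
  have "matrix_power S Q (Suc (Suc n)) x y = (\<Sum>w\<in>S. Q x w * (\<Sum>z\<in>S. matrix_power S Q n w z * Q z y))"
    unfolding matrix_power.simps(2)[of S Q "Suc n"] using Suc.IH by (intro sum.cong) auto
  also have "\<dots> = (\<Sum>z\<in>S. \<Sum>w\<in>S. Q x w * matrix_power S Q n w z * Q z y)"
    by (subst sum.swap) (simp add: sum_distrib_left mult.assoc)
  finally show ?case by (simp add: sum_distrib_right)
qed

text \<open>The sum of all absolute entries dominates every row sum of absolute values, so each
  further factor \<open>Q\<close> costs at most one factor of it. The crude constant suffices, since
  it only has to make the exponential series converge.\<close>

lemma abs_matrix_power_le:
  assumes "finite S" "x \<in> S"
  shows "\<bar>matrix_power S Q n x y\<bar> \<le> (\<Sum>x\<in>S. \<Sum>z\<in>S. \<bar>Q x z\<bar>) ^ n"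
  using assms(2)
proof (induction n arbitrary: x)
  case 0
  then show ?case by simp
next
  case (Suc n)
  define C where "C = (\<Sum>x\<in>S. \<Sum>z\<in>S. \<bar>Q x z\<bar>)"
  have "C \<ge> 0" by (simp add: C_def sum_nonneg)
  have "\<bar>matrix_power S Q (Suc n) x y\<bar> \<le> (\<Sum>z\<in>S. \<bar>Q x z\<bar> * \<bar>matrix_power S Q n z y\<bar>)"
    by (simp flip: abs_mult)
  also have "\<dots> \<le> (\<Sum>z\<in>S. \<bar>Q x z\<bar> * C ^ n)"
    using Suc.IH by (intro sum_mono mult_left_mono) (auto simp: C_def)
  also have "\<dots> = (\<Sum>z\<in>S. \<bar>Q x z\<bar>) * C ^ n" by (simp add: sum_distrib_right)
  also have "\<dots> \<le> C * C ^ n"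
    unfolding C_def using \<open>finite S\<close> Suc.prems
    by (intro mult_right_mono member_le_sum[where f="\<lambda>x. \<Sum>z\<in>S. \<bar>Q x z\<bar>"] zero_le_power sum_nonneg) auto
  finally show ?case by (simp add: C_def)
qed

lemma summable_matrix_power_series:
  assumes "finite S" "x \<in> S"
  shows "summable (\<lambda>n. matrix_power S Q n x y / fact n * t ^ n)"
proof -
  define C where "C = (\<Sum>x\<in>S. \<Sum>z\<in>S. \<bar>Q x z\<bar>)"
  have "summable (\<lambda>n. inverse (fact n) * (C * \<bar>t\<bar>) ^ n)"
    by (rule summable_exp)
  then show ?thesis
  proof (rule summable_comparison_test'[where N=0])
    fix n
    have "\<bar>matrix_power S Q n x y\<bar> * \<bar>t\<bar> ^ n \<le> C ^ n * \<bar>t\<bar> ^ n"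
      using abs_matrix_power_le[OF assms] by (intro mult_right_mono) (auto simp: C_def)
    then show "norm (matrix_power S Q n x y / fact n * t ^ n) \<le> inverse (fact n) * (C * \<bar>t\<bar>) ^ n"
      by (simp add: abs_mult power_abs power_mult_distrib divide_simps)
  qed
qed

text \<open>Termwise differentiation of an everywhere convergent power series turns the coefficient
  \<open>Q^n / n!\<close> into \<open>Q^(n+1) / n!\<close>. Splitting off the last factor on the
  right, by \<open>matrix_power_Suc_right\<close>, gives the forward form; the recursion defining
  \<open>matrix_power\<close> would give the backward one.\<close>

lemma transition_prob_forward:
  assumes "finite S" "x \<in> S" "y \<in> S"
  shows "((\<lambda>t. transition_prob S Q t x y) has_real_derivative
           (\<Sum>z\<in>S. transition_prob S Q t x z * Q z y)) (at t)"
proof -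
  define c where "c = (\<lambda>n. matrix_power S Q n x y / fact n)"
  have "((\<lambda>t. \<Sum>n. c n * t ^ n) has_real_derivative (\<Sum>n. diffs c n * t ^ n)) (at t)"
    unfolding c_def
    by (intro termdiffs_strong_converges_everywhere summable_matrix_power_series assms)
  moreover have "(\<lambda>t. \<Sum>n. c n * t ^ n) = (\<lambda>t. transition_prob S Q t x y)"
    by (simp add: transition_prob_def c_def mult.commute)
  moreover have "(\<Sum>n. diffs c n * t ^ n) = (\<Sum>z\<in>S. transition_prob S Q t x z * Q z y)"
  proof -
    have "diffs c n = matrix_power S Q (Suc n) x y / fact n" for n
      by (simp add: diffs_def c_def divide_simps del: matrix_power.simps)
    then have "(\<Sum>n. diffs c n * t ^ n) =
        (\<Sum>n. \<Sum>z\<in>S. matrix_power S Q n x z / fact n * t ^ n * Q z y)"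
      by (simp add: matrix_power_Suc_right[OF assms] sum_distrib_right sum_divide_distrib
          mult.assoc mult.commute[of "Q _ y"] del: matrix_power.simps)
    also have "\<dots> = (\<Sum>z\<in>S. \<Sum>n. matrix_power S Q n x z / fact n * t ^ n * Q z y)"
      by (intro suminf_sum summable_mult2 summable_matrix_power_series assms)
    also have "\<dots> = (\<Sum>z\<in>S. (\<Sum>n. matrix_power S Q n x z / fact n * t ^ n) * Q z y)"
      by (intro sum.cong refl suminf_mult2[symmetric] summable_matrix_power_series assms)
    finally show ?thesis by (simp add: transition_prob_def mult.commute)
  qed
  ultimately show ?thesis by simp
qed

text \<open>\<open>Q\<close> is block triangular with respect to \<open>A\<close>, and so are all
  its powers: every term of the exponential series vanishes at such an entry.\<close>

lemma transition_prob_closed: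
  assumes closed: "\<And>x y. x \<in> S \<inter> A \<Longrightarrow> y \<in> S - A \<Longrightarrow> Q x y = 0"
    and "x \<in> S \<inter> A" "y \<in> S - A"
  shows "transition_prob S Q t x y = 0"
proof -
  have "matrix_power S Q n x y = 0" for n
    using assms(2)
  proof (induction n arbitrary: x)
    case 0
    then show ?case using assms(3) by auto
  next
    case (Suc n)
    have "Q x z * matrix_power S Q n z y = 0" if "z \<in> S" for z
      using Suc.IH[of z] closed[OF Suc.prems, of z] that by (cases "z \<in> A") auto
    then show ?case by (simp add: sum.neutral del: mult_eq_0_iff)
  qed
  then show ?thesis by (simp add: transition_prob_def)
qed

section \<open>Marginals, the two-time Markov property and absorption\<close>

lemma ctmc_from_markov:
  assumes X: "ctmc_from M S Q s X" and "x \<in> S" "y \<in> S" "0 \<le> t" "t \<le> u"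
    and pos: "\<P>(\<omega> in M. X t \<omega> = x) > 0"
  shows "\<P>(\<omega> in M. X u \<omega> = y \<and> X t \<omega> = x) =
    transition_prob S Q (u - t) x y * \<P>(\<omega> in M. X t \<omega> = x)"
proof -
  have "\<forall>(n::nat) (t :: nat \<Rightarrow> real) (x :: nat \<Rightarrow> _) u y.
        0 \<le> t 0 \<and> (\<forall>i<n. t i \<le> t (Suc i)) \<and> t n \<le> u \<and> (\<forall>i\<le>n. x i \<in> S) \<and> y \<in> S \<and>
        \<P>(\<omega> in M. \<forall>i\<le>n. X (t i) \<omega> = x i) > 0 \<longrightarrow>
        \<P>(\<omega> in M. X u \<omega> = y \<bar> \<forall>i\<le>n. X (t i) \<omega> = x i)
          = transition_prob S Q (u - t n) (x n) y"
    using X unfolding ctmc_from_def by (elim conjE)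
  \<comment> \<open>The case \<open>n = 0\<close> conditions on a single time, so constant sequences
    of times and states serve.\<close>
  from this[THEN spec, of 0, THEN spec, of "\<lambda>_. t", THEN spec, of "\<lambda>_. x", THEN spec, of u, THEN spec, of y]
  have "\<P>(\<omega> in M. X u \<omega> = y \<bar> X t \<omega> = x) = transition_prob S Q (u - t) x y"
    using assms by simp
  then show ?thesis using pos by (simp add: cond_prob_def field_simps)
qed

lemma ctmc_from_marginal:
  assumes "ctmc_from M S Q s X" "s \<in> S" "y \<in> S" "t \<ge> 0"
  shows "\<P>(\<omega> in M. X t \<omega> = y) = transition_prob S Q t s y"
proof -
  interpret prob_space M using assms by (simp add: ctmc_from_def)
  have [measurable]: "X 0 \<in> measurable M (count_space S)" "X t \<in> measurable M (count_space S)"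
    using assms by (auto simp: ctmc_from_def)
  have one: "\<P>(\<omega> in M. X 0 \<omega> = s) = 1"
    using assms by (simp add: ctmc_from_def)
  have "\<P>(\<omega> in M. X t \<omega> = y \<and> X 0 \<omega> = s) = transition_prob S Q t s y"
    using ctmc_from_markov[OF assms(1-3), of 0 t] one assms(4) by simp
  moreover have "AE \<omega> in M. X 0 \<omega> = s"
    using one by (subst (asm) prob_Collect_eq_1) auto
  then have "\<P>(\<omega> in M. X t \<omega> = y \<and> X 0 \<omega> = s) = \<P>(\<omega> in M. X t \<omega> = y)"
    by (intro finite_measure_eq_AE) auto
  ultimately show ?thesis by simp
qed

text \<open>The Markov clause speaks only about conditioning events of positive probability. If
  \<open>X t = x\<close> is a null event, monotonicity of the measure gives the claim
  instead.\<close>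

lemma ctmc_from_joint_eq_0:
  assumes "ctmc_from M S Q s X" "x \<in> S" "y \<in> S" "0 \<le> t" "t \<le> u"
    and "transition_prob S Q (u - t) x y = 0"
  shows "\<P>(\<omega> in M. X t \<omega> = x \<and> X u \<omega> = y) = 0"
proof -
  interpret prob_space M using assms by (simp add: ctmc_from_def)
  have [measurable]: "X t \<in> measurable M (count_space S)" "X u \<in> measurable M (count_space S)"
    using assms by (auto simp: ctmc_from_def)
  show ?thesis
  proof (cases "\<P>(\<omega> in M. X t \<omega> = x) = 0")
    case True
    have "\<P>(\<omega> in M. X t \<omega> = x \<and> X u \<omega> = y) \<le> \<P>(\<omega> in M. X t \<omega> = x)"
      by (intro finite_measure_mono) auto
    then show ?thesis using True by (simp add: measure_le_0_iff)
  next
    case False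
    then have pos: "\<P>(\<omega> in M. X t \<omega> = x) > 0" by (simp add: zero_less_measure_iff)
    show ?thesis
      using ctmc_from_markov[OF assms(1-5) pos] assms(6) by (simp add: conj_commute)
  qed
qed

text \<open>For two fixed times, leaving \<open>A\<close> is a finite union of null events, one for
  each pair of states. The exceptional set depends on the times, so they are restricted to the
  countable set of rationals before the null sets are united.\<close>

lemma ctmc_from_AE_rational_mono:
  assumes X: "ctmc_from M S Q s X" and "finite S"
    and closed: "\<And>x y. x \<in> S \<inter> A \<Longrightarrow> y \<in> S - A \<Longrightarrow> Q x y = 0"
  shows "AE \<omega> in M. \<forall>p\<in>\<rat>. \<forall>q\<in>\<rat>. 0 \<le> p \<longrightarrow> p \<le> q \<longrightarrow> X p \<omega> \<in> A \<longrightarrow> X q \<omega> \<in> A"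
proof -
  interpret prob_space M using X by (simp add: ctmc_from_def)
  have "AE \<omega> in M. 0 \<le> p \<longrightarrow> p \<le> q \<longrightarrow> X p \<omega> \<in> A \<longrightarrow> X q \<omega> \<in> A" for p q
  proof (cases "0 \<le> p \<and> p \<le> q")
    case True
    have meas[measurable]: "X p \<in> measurable M (count_space S)" "X q \<in> measurable M (count_space S)"
      using X True by (auto simp: ctmc_from_def)
    have "AE \<omega> in M. \<not> (X p \<omega> = x \<and> X q \<omega> = y)" if "x \<in> S \<inter> A" "y \<in> S - A" for x y
    proof (subst prob_Collect_eq_0[symmetric])
      show "\<P>(\<omega> in M. X p \<omega> = x \<and> X q \<omega> = y) = 0"
        using True that transition_prob_closed[OF closed that]
        by (intro ctmc_from_joint_eq_0[OF X]) auto
    qed auto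
    then have "AE \<omega> in M. \<forall>x\<in>S \<inter> A. \<forall>y\<in>S - A. \<not> (X p \<omega> = x \<and> X q \<omega> = y)"
      using \<open>finite S\<close> by (intro AE_finite_allI) auto
    then show ?thesis
      using AE_space
    proof eventually_elim
      case (elim \<omega>)
      \<comment> \<open>Measurability into \<open>count_space S\<close> keeps the path inside
        \<open>S\<close>, so a value outside \<open>A\<close> lies in \<open>S - A\<close>.\<close>
      then show ?case using meas[THEN measurable_space, of \<omega>] by auto
    qed
  qed simp
  then show ?thesis by (intro AE_ball_countable' countable_rat) auto
qed

section \<open>Hitting times and their tail integral\<close>

text \<open>A statement about one path: right-continuity carries absorption from rational to real
  times. It also keeps the path constant on some \<open>[t, b)\<close>, which makes the inequality
  strict although the infimum defining the hitting time need not come with a gap by itself.\<close>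

lemma hitting_time_gt_iff:
  fixes X :: "real \<Rightarrow> 'w \<Rightarrow> 's"
  assumes cont: "\<And>t. t \<ge> 0 \<Longrightarrow> \<forall>\<^sub>F u in at_right t. X u \<omega> = X t \<omega>"
    and mono: "\<And>p q. p \<in> \<rat> \<Longrightarrow> q \<in> \<rat> \<Longrightarrow> 0 \<le> p \<Longrightarrow> p \<le> q \<Longrightarrow> X p \<omega> \<in> A \<Longrightarrow> X q \<omega> \<in> A"
    and "t \<ge> 0"
  shows "ennreal t < hitting_time X A \<omega> \<longleftrightarrow> X t \<omega> \<notin> A"
proof
  assume "ennreal t < hitting_time X A \<omega>"
  moreover have "hitting_time X A \<omega> \<le> ennreal t" if "X t \<omega> \<in> A"
    unfolding hitting_time_def using that \<open>t \<ge> 0\<close> by (intro Inf_lower) auto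
  ultimately show "X t \<omega> \<notin> A" by (meson leD)
next
  have right: "\<exists>b>v. \<forall>u. v \<le> u \<and> u < b \<longrightarrow> X u \<omega> = X v \<omega>" if v: "v \<ge> 0" for v
  proof -
    obtain b where "b > v" "\<And>u. v < u \<Longrightarrow> u < b \<Longrightarrow> X u \<omega> = X v \<omega>"
      using cont[OF v] unfolding eventually_at_right_field by blast
    then have "v \<le> u \<Longrightarrow> u < b \<Longrightarrow> X u \<omega> = X v \<omega>" for u
      by (cases "u = v") auto
    with \<open>b > v\<close> show ?thesis by blast
  qed
  assume notin: "X t \<omega> \<notin> A"
  obtain b where b: "b > t" "\<And>u. t \<le> u \<Longrightarrow> u < b \<Longrightarrow> X u \<omega> = X t \<omega>"
    using right[OF \<open>t \<ge> 0\<close>] by blast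
  have "b \<le> v" if v: "v \<ge> 0" "X v \<omega> \<in> A" for v
  proof (rule ccontr)
    assume "\<not> b \<le> v"
    obtain c where c: "c > v" "\<And>u. v \<le> u \<Longrightarrow> u < c \<Longrightarrow> X u \<omega> = X v \<omega>"
      using right[OF v(1)] by blast
    \<comment> \<open>If \<open>A\<close> were visited at some \<open>v < b\<close>, the path would
      still be in \<open>A\<close> at a rational \<open>p\<close> just after \<open>v\<close>, hence
      at a later rational \<open>q\<close> in \<open>(t, b)\<close>. There the path still has the
      value \<open>X t \<omega>\<close>, which is outside \<open>A\<close>.\<close>
    obtain p where p: "p \<in> \<rat>" "v < p" "p < min c b"
      using Rats_dense_in_real[of v "min c b"] c(1) \<open>\<not> b \<le> v\<close> by auto
    obtain q where q: "q \<in> \<rat>" "max p t < q" "q < b"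
      using Rats_dense_in_real[of "max p t" b] p b(1) by auto
    have "X q \<omega> \<in> A" using mono[of p q] p q v c(2)[of p] by simp
    then show False using b(2)[of q] q notin by simp
  qed
  then have ge: "ennreal b \<le> hitting_time X A \<omega>"
    unfolding hitting_time_def by (intro Inf_greatest) (auto simp: ennreal_leI)
  have "ennreal t < ennreal b"
    using b(1) \<open>t \<ge> 0\<close> by (simp add: ennreal_less_iff)
  then show "ennreal t < hitting_time X A \<omega>"
    using ge by (rule order.strict_trans2)
qed

text \<open>Layer-cake formula: \<open>T \<omega>\<close> is the length of the set of
  \<open>t \<ge> 0\<close> below it, also when it is infinite, and Tonelli exchanges the two
  integrals.\<close>

lemma (in prob_space) nn_integral_tail:
  assumes [measurable]: "T \<in> borel_measurable M"
  shows "(\<integral>\<^sup>+ \<omega>. T \<omega> \<partial>M) = (\<integral>\<^sup>+ t. emeasure M {\<omega> \<in> space M. ennreal t < T \<omega>} * indicator {0..} t \<partial>lborel)"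
proof -
  interpret P: pair_sigma_finite M lborel
    by (simp add: pair_sigma_finite_def sigma_finite_measure_axioms lborel.sigma_finite_measure_axioms)
  have len: "(\<integral>\<^sup>+ t. indicator {t. 0 \<le> t \<and> ennreal t < c} t \<partial>lborel) = c" for c
  proof (cases c)
    case (real r)
    then have "{t. 0 \<le> t \<and> ennreal t < c} = {0..<r}" by (auto simp: ennreal_less_iff)
    then show ?thesis using real by simp
  next
    case top
    then have "{t. 0 \<le> t \<and> ennreal t < c} = {0..}" by auto
    moreover have "emeasure lborel {0::real..} = \<infinity>"
    proof (rule ccontr)
      assume fin: "emeasure lborel {0::real..} \<noteq> \<infinity>"
      have "emeasure lborel {0..r} \<le> emeasure lborel {0::real..}" for r :: real
        by (intro emeasure_mono) auto
      then have le: "ennreal r \<le> emeasure lborel {0::real..}" if "r \<ge> 0" for r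
        using that by (metis emeasure_lborel_Icc diff_zero)
      obtain m where "emeasure lborel {0::real..} = ennreal m" "m \<ge> 0"
        using fin by (cases "emeasure lborel {0::real..}") auto
      then show False using le[of "m + 1"] by simp
    qed
    ultimately show ?thesis using top by simp
  qed
  have "(\<integral>\<^sup>+ \<omega>. T \<omega> \<partial>M) = (\<integral>\<^sup>+ \<omega>. \<integral>\<^sup>+ t. indicator {t. 0 \<le> t \<and> ennreal t < T \<omega>} t \<partial>lborel \<partial>M)"
    by (simp only: len)
  also have "\<dots> = (\<integral>\<^sup>+ t. \<integral>\<^sup>+ \<omega>. indicator {t. 0 \<le> t \<and> ennreal t < T \<omega>} t \<partial>M \<partial>lborel)"
    by (rule P.Fubini'[symmetric]) (simp add: indicator_def)
  also have "\<dots> = (\<integral>\<^sup>+ t. \<integral>\<^sup>+ \<omega>. indicator {\<omega> \<in> space M. ennreal t < T \<omega>} \<omega> * indicator {0..} t \<partial>M \<partial>lborel)"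
    by (intro nn_integral_cong) (auto simp: indicator_def)
  finally show ?thesis by (simp add: nn_integral_multc)
qed

lemma mean_hitting_time_tail:
  assumes X: "ctmc_from M S Q s X" and "finite S"
    and closed: "\<And>x y. x \<in> S \<inter> A \<Longrightarrow> y \<in> S - A \<Longrightarrow> Q x y = 0"
  shows "mean_hitting_time M X A =
    (\<integral>\<^sup>+ t. ennreal (\<P>(\<omega> in M. X t \<omega> \<notin> A)) * indicator {0..} t \<partial>lborel)"
proof -
  interpret prob_space M using X by (simp add: ctmc_from_def)
  have meas[measurable]: "t \<ge> 0 \<Longrightarrow> X t \<in> measurable M (count_space S)" for t
    using X by (auto simp: ctmc_from_def)
  \<comment> \<open>The hitting time is an infimum over uncountably many times, so its measurability
    is not immediate. \<open>T\<close> is a measurable stand-in over rational times, with default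
    \<open>\<top>\<close> for times at which the path is outside \<open>A\<close>.\<close>
  define T where "T = (\<lambda>\<omega>. INF q\<in>\<rat> \<inter> {0..}. if X q \<omega> \<in> A then ennreal q else \<top>)"
  have rational_mono: "AE \<omega> in M. \<forall>p\<in>\<rat>. \<forall>q\<in>\<rat>. 0 \<le> p \<longrightarrow> p \<le> q \<longrightarrow> X p \<omega> \<in> A \<longrightarrow> X q \<omega> \<in> A"
    by (rule ctmc_from_AE_rational_mono[OF X \<open>finite S\<close>]) (rule closed)
  have good: "AE \<omega> in M. \<forall>t\<ge>0. ennreal t < hitting_time X A \<omega> \<longleftrightarrow> X t \<omega> \<notin> A"
    using rational_mono AE_space
  proof eventually_elim
    case (elim \<omega>)
    then show ?case using X by (intro allI impI hitting_time_gt_iff) (auto simp: ctmc_from_def)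
  qed
  have T_meas[measurable]: "T \<in> borel_measurable M"
    unfolding T_def
  proof (rule borel_measurable_INF)
    fix q :: real assume "q \<in> \<rat> \<inter> {0..}"
    then have "X q \<in> measurable M (count_space S)" by auto
    from measurable_compose[OF this, of "\<lambda>x. if x \<in> A then ennreal q else \<top>" borel]
    show "(\<lambda>\<omega>. if X q \<omega> \<in> A then ennreal q else \<top>) \<in> borel_measurable M" by simp
  qed (auto intro: countable_Int1 countable_rat)
  have AE_T: "AE \<omega> in M. hitting_time X A \<omega> = T \<omega>"
    using good
  proof eventually_elim
    case (elim \<omega>)
    show ?case
    proof (rule antisym)
      show "hitting_time X A \<omega> \<le> T \<omega>"
        unfolding T_def hitting_time_def by (intro INF_greatest) (auto intro: Inf_lower)
      show "T \<omega> \<le> hitting_time X A \<omega>"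
      proof (rule ccontr)
        assume "\<not> T \<omega> \<le> hitting_time X A \<omega>"
        \<comment> \<open>A rational \<open>q\<close> strictly between the hitting time and
          \<open>T \<omega>\<close> would satisfy \<open>X q \<omega> \<in> A\<close> by absorption,
          which forces \<open>T \<omega> \<le> q\<close>.\<close>
        then have less: "hitting_time X A \<omega> < T \<omega>" by simp
        then obtain r where r: "r \<ge> 0" "hitting_time X A \<omega> = ennreal r"
          by (cases "hitting_time X A \<omega>") auto
        obtain c where c: "hitting_time X A \<omega> < c" "c < T \<omega>"
          using dense[OF less] by blast
        then obtain b where b: "b \<ge> 0" "c = ennreal b"
          by (cases c) auto
        have "r < b" using c(1) b r by (simp add: ennreal_less_iff)
        obtain q where q: "q \<in> \<rat>" "r < q" "q < b" using Rats_dense_in_real[OF \<open>r < b\<close>] by blast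
        have "X q \<omega> \<in> A" using elim[rule_format, of q] q r by (auto simp: ennreal_less_iff)
        then have "T \<omega> \<le> ennreal q"
          unfolding T_def using q r by (intro INF_lower2[of q]) auto
        also have "\<dots> \<le> ennreal b" using q by (intro ennreal_leI) auto
        finally show False using b c(2) by simp
      qed
    qed
  qed
  have "mean_hitting_time M X A = (\<integral>\<^sup>+ \<omega>. T \<omega> \<partial>M)"
    unfolding mean_hitting_time_def using AE_T by (rule nn_integral_cong_AE)
  also have "\<dots> = (\<integral>\<^sup>+ t. emeasure M {\<omega> \<in> space M. ennreal t < T \<omega>} * indicator {0..} t \<partial>lborel)"
    by (rule nn_integral_tail) measurable
  also have "\<dots> = (\<integral>\<^sup>+ t. ennreal (\<P>(\<omega> in M. X t \<omega> \<notin> A)) * indicator {0..} t \<partial>lborel)"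
  proof (intro nn_integral_cong)
    fix t :: real
    show "emeasure M {\<omega> \<in> space M. ennreal t < T \<omega>} * indicator {0..} t
        = ennreal (\<P>(\<omega> in M. X t \<omega> \<notin> A)) * indicator {0..} t"
    proof (cases "t \<ge> 0")
      case True
      have [measurable]: "Measurable.pred M (\<lambda>\<omega>. X t \<omega> \<notin> A)"
        by (rule measurable_compose[OF meas[OF True]]) simp
      have "emeasure M {\<omega> \<in> space M. ennreal t < T \<omega>} = emeasure M {\<omega> \<in> space M. X t \<omega> \<notin> A}"
      proof (rule emeasure_eq_AE)
        show "AE \<omega> in M. \<omega> \<in> {\<omega> \<in> space M. ennreal t < T \<omega>} \<longleftrightarrow> \<omega> \<in> {\<omega> \<in> space M. X t \<omega> \<notin> A}"
          using good AE_T by eventually_elim (use True in auto)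
      qed auto
      then show ?thesis by (simp add: emeasure_eq_measure)
    qed simp
  qed
  finally show ?thesis .
qed

section \<open>The Poisson equation for mean hitting times\<close>

lemma exp_decay_tendsto_0:
  fixes g g' :: "real \<Rightarrow> real"
  assumes "c > 0"
    and deriv: "\<And>t. t \<ge> 0 \<Longrightarrow> (g has_real_derivative g' t) (at t)"
    and le: "\<And>t. t \<ge> 0 \<Longrightarrow> g' t \<le> - c * g t"
    and nonneg: "\<And>t. t \<ge> 0 \<Longrightarrow> g t \<ge> 0"
  shows "(g \<longlongrightarrow> 0) at_top"
proof (rule tendsto_sandwich)
  have bound: "g t \<le> g 0 * exp (- c * t)" if "t \<ge> 0" for t
  proof -
    \<comment> \<open>Integrating factor: the hypothesis on \<open>g'\<close> says exactly that
      \<open>g t * exp (c * t)\<close> has nonpositive derivative.\<close>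
    have "g t * exp (c * t) \<le> g 0 * exp (c * 0)"
    proof (rule DERIV_nonpos_imp_nonincreasing[OF that])
      fix u assume u: "0 \<le> u" "u \<le> t"
      have "((\<lambda>t. g t * exp (c * t)) has_real_derivative (g' u + c * g u) * exp (c * u)) (at u)"
        using deriv[OF u(1)] by (auto intro!: derivative_eq_intros simp: algebra_simps)
      moreover have "(g' u + c * g u) * exp (c * u) \<le> 0"
        using le[OF u(1)] by (intro mult_nonpos_nonneg) auto
      ultimately show "\<exists>y. ((\<lambda>t. g t * exp (c * t)) has_real_derivative y) (at u) \<and> y \<le> 0" by blast
    qed
    then show ?thesis by (simp add: exp_minus field_simps)
  qed
  show "\<forall>\<^sub>F t in at_top. g t \<le> g 0 * exp (- c * t)"
    using eventually_ge_at_top[of 0] by eventually_elim (rule bound)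
  show "\<forall>\<^sub>F t in at_top. 0 \<le> g t"
    using eventually_ge_at_top[of 0] by eventually_elim (rule nonneg)
  show "((\<lambda>t. g 0 * exp (- c * t)) \<longlongrightarrow> 0) at_top"
    using \<open>c > 0\<close> by real_asymp
qed simp

theorem mean_hitting_time_eq_poisson_solution:
  fixes h :: "'s \<Rightarrow> real"
  assumes X: "ctmc_from M S Q s X" and "finite S" "s \<in> S"
    and closed: "\<And>x y. x \<in> S \<inter> A \<Longrightarrow> y \<in> S - A \<Longrightarrow> Q x y = 0"
    and nonneg: "\<And>x. x \<in> S \<Longrightarrow> h x \<ge> 0"
    and zero: "\<And>x. x \<in> S \<inter> A \<Longrightarrow> h x = 0"
    and poisson: "\<And>x. x \<in> S - A \<Longrightarrow> (\<Sum>y\<in>S. Q x y * h y) = - 1"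
  shows "mean_hitting_time M X A = ennreal (h s)"
proof -
  interpret prob_space M using X by (simp add: ctmc_from_def)
  define P where "P = (\<lambda>t y. transition_prob S Q t s y)"
  define g where "g = (\<lambda>t. \<Sum>y\<in>S. P t y * h y)"
  define p where "p = (\<lambda>t. \<Sum>y\<in>S - A. P t y)"
  have P_prob: "\<P>(\<omega> in M. X t \<omega> = y) = P t y" if "t \<ge> 0" "y \<in> S" for t y
    using ctmc_from_marginal[OF X] that \<open>s \<in> S\<close> by (simp add: P_def)
  \<comment> \<open>Nonnegativity of the entries of the semigroup comes from their being
    probabilities of the given realization.\<close>
  then have P_nonneg: "P t y \<ge> 0" if "t \<ge> 0" "y \<in> S" for t y
    using that by (metis measure_nonneg)
  have P_deriv: "((\<lambda>t. P t y) has_real_derivative (\<Sum>z\<in>S. P t z * Q z y)) (at t)" if "y \<in> S" for t y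
    unfolding P_def by (rule transition_prob_forward) (use assms that in auto)
  have p_prob: "\<P>(\<omega> in M. X t \<omega> \<notin> A) = p t" if "t \<ge> 0" for t
  proof -
    have meas[measurable]: "X t \<in> measurable M (count_space S)"
      using X that by (auto simp: ctmc_from_def)
    have "{\<omega> \<in> space M. X t \<omega> \<notin> A} = (\<Union>y\<in>S - A. {\<omega> \<in> space M. X t \<omega> = y})"
      using measurable_space[OF meas] by auto
    also have "prob \<dots> = (\<Sum>y\<in>S - A. \<P>(\<omega> in M. X t \<omega> = y))"
      using \<open>finite S\<close> by (intro finite_measure_finite_Union) (auto simp: disjoint_family_on_def)
    finally show ?thesis using P_prob[OF that] by (simp add: p_def)
  qed
  \<comment> \<open>The Poisson equation extends to all of \<open>S\<close>: a row indexed by a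
    state of \<open>A\<close> is supported in \<open>A\<close>, where \<open>h\<close>
    vanishes.\<close>
  have Qh: "(\<Sum>y\<in>S. Q x y * h y) = - of_bool (x \<notin> A)" if "x \<in> S" for x
  proof (cases "x \<in> A")
    case True
    have "Q x y * h y = 0" if "y \<in> S" for y
      using closed[of x y] zero[of y] True \<open>x \<in> S\<close> that by (cases "y \<in> A") auto
    then show ?thesis using True by (simp add: sum.neutral del: mult_eq_0_iff)
  next
    case False
    then show ?thesis using poisson[of x] that by simp
  qed
  have g_deriv: "(g has_real_derivative - p t) (at t)" for t
  proof -
    have "(g has_real_derivative (\<Sum>y\<in>S. (\<Sum>z\<in>S. P t z * Q z y) * h y)) (at t)"
      unfolding g_def by (intro DERIV_sum DERIV_cmult_right P_deriv)
    also have "(\<Sum>y\<in>S. (\<Sum>z\<in>S. P t z * Q z y) * h y) = (\<Sum>z\<in>S. P t z * (\<Sum>y\<in>S. Q z y * h y))"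
      by (simp add: sum_distrib_left sum_distrib_right mult.assoc) (rule sum.swap)
    also have "\<dots> = (\<Sum>z\<in>S. - (if z \<in> - A then P t z else 0))"
      by (intro sum.cong) (auto simp: Qh)
    also have "\<dots> = - p t"
      unfolding p_def Diff_eq sum.inter_restrict[OF \<open>finite S\<close>] by (rule sum_negf)
    finally show ?thesis .
  qed
  \<comment> \<open>An upper bound for \<open>h\<close> on \<open>S\<close>; the summand 1 makes it
    positive even if \<open>h\<close> is zero, so that \<open>1 / C\<close> can be the decay
    rate.\<close>
  define C where "C = 1 + (\<Sum>y\<in>S. h y)"
  have "C > 0" using nonneg by (auto simp: C_def intro!: add_pos_nonneg sum_nonneg)
  have g_nonneg: "g t \<ge> 0" if "t \<ge> 0" for t
    unfolding g_def using P_nonneg nonneg that by (intro sum_nonneg mult_nonneg_nonneg) auto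
  have g_le: "g t \<le> C * p t" if "t \<ge> 0" for t
  proof -
    have "g t = (\<Sum>y\<in>S - A. P t y * h y)"
      unfolding g_def using \<open>finite S\<close> zero by (intro sum.mono_neutral_right) auto
    also have "\<dots> \<le> (\<Sum>y\<in>S - A. P t y * C)"
    proof (intro sum_mono mult_left_mono)
      fix y assume "y \<in> S - A"
      then have "h y \<le> (\<Sum>y\<in>S. h y)" using nonneg \<open>finite S\<close> by (intro member_le_sum) auto
      then show "h y \<le> C" by (simp add: C_def)
    qed (use P_nonneg that in auto)
    finally show ?thesis by (simp add: p_def mult.commute[of C] sum_distrib_right)
  qed
  have "(g \<longlongrightarrow> 0) at_top"
  proof (rule exp_decay_tendsto_0)
    show "- p t \<le> - (1 / C) * g t" if "t \<ge> 0" for t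
      using g_le[OF that] \<open>C > 0\<close> by (simp add: field_simps)
  qed (use \<open>C > 0\<close> g_deriv g_nonneg in auto)
  then have lim: "((\<lambda>t. - g t) \<longlongrightarrow> 0) at_top" using tendsto_minus by fastforce
  have "mean_hitting_time M X A = (\<integral>\<^sup>+ t. ennreal (p t) * indicator {0..} t \<partial>lborel)"
  proof (subst mean_hitting_time_tail[OF X \<open>finite S\<close>])
    show "Q x y = 0" if "x \<in> S \<inter> A" "y \<in> S - A" for x y
      using closed that by blast
  qed (auto intro!: nn_integral_cong simp: p_prob indicator_def)
  \<comment> \<open>The antiderivative of \<open>p\<close> is \<open>- g\<close>, with limit 0 at
    infinity by the exponential decay.\<close>
  also have "\<dots> = ennreal (0 - (- g 0))"
  proof (rule nn_integral_FTC_atLeast[OF _ _ _ lim])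
    have "continuous_on UNIV p"
      unfolding p_def using P_deriv
      by (intro continuous_on_sum) (auto intro!: DERIV_atLeastAtMost_imp_continuous_on DERIV_isCont
          simp: continuous_on_eq_continuous_at)
    then show "p \<in> borel_measurable borel" by (rule borel_measurable_continuous_onI)
    show "((\<lambda>t. - g t) has_real_derivative p t) (at t)" for t
      using DERIV_minus[OF g_deriv] by simp
    show "0 \<le> p t" if "0 \<le> t" for t
      unfolding p_def using P_nonneg that by (intro sum_nonneg) auto
  qed
  also have "g 0 = h s"
  proof -
    have P0: "P 0 y = (if y = s then 1 else 0)" for y
      using powser_zero[of "\<lambda>n. matrix_power S Q n s y / fact n"]
      by (simp add: P_def transition_prob_def mult.commute)
    show ?thesis using \<open>finite S\<close> \<open>s \<in> S\<close>
      by (simp add: g_def P0 if_distrib[of "\<lambda>u. u * _"] cong: if_cong)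
  qed
  finally show ?thesis by simp
qed

section \<open>Verification for the two-channel chain\<close>

text \<open>The diagonal entry is minus the total exit rate, so it can be distributed over the
  jumps. In the difference form only the rates themselves have to be evaluated.\<close>

lemma sum_generator_mult:
  assumes "finite S" "x \<in> S"
  shows "(\<Sum>y\<in>S. generator S r x y * h y) = (\<Sum>y\<in>S - {x}. r x y * (h y - h x))"
proof -
  have "(\<Sum>y\<in>S. generator S r x y * h y) =
      generator S r x x * h x + (\<Sum>y\<in>S - {x}. generator S r x y * h y)"
    using assms by (rule sum.remove)
  also have "(\<Sum>y\<in>S - {x}. generator S r x y * h y) = (\<Sum>y\<in>S - {x}. r x y * h y)"
    by (intro sum.cong) (auto simp: generator_def)
  finally show ?thesis
    by (simp add: generator_def right_diff_distrib sum_subtractf sum_distrib_right)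
qed

text \<open>The claimed solution, extended by 0 over vertex 3. Within \<open>states\<close> the last
  branch is reached only from \<open>(2, 2)\<close> and \<open>(4, 1)\<close>.\<close>

definition two_channel_mean_time :: "real \<Rightarrow> real \<Rightarrow> nat \<times> nat \<Rightarrow> real" where
  "two_channel_mean_time k \<epsilon> x =
     (if fst x = 3 then 0
      else if fst x = 1 then 4 / k + 2 / \<epsilon>
      else if x = (2, 1) \<or> x = (4, 2) then 3 / k + 2 / \<epsilon>
      else 3 / k)"

lemma states_eq: "states = {(1,1), (1,2), (2,1), (2,2), (3,1), (3,2), (4,1), (4,2)}"
  by (auto simp: states_def)

text \<open>Up to the symmetry exchanging the channels and the vertices 2 and 4, there are three
  balances of jump and switch terms: \<open>-1 + 0\<close> at \<open>(1, 1)\<close>,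
  \<open>1 - 2\<close> at \<open>(2, 1)\<close> and \<open>-3 + 2\<close> at
  \<open>(4, 1)\<close>.\<close>

lemma two_channel_mean_time_poisson:
  assumes "k > 0" "\<epsilon> > 0" "x \<in> states" "fst x \<noteq> 3"
  shows "(\<Sum>y\<in>states. generator states (rate k \<epsilon>) x y * two_channel_mean_time k \<epsilon> y) = - 1"
proof -
  have "(\<Sum>y\<in>states - {x}. rate k \<epsilon> x y * (two_channel_mean_time k \<epsilon> y - two_channel_mean_time k \<epsilon> x)) = - 1"
    using assms unfolding states_eq
    by (simp, elim disjE)
       (simp_all add: insert_Diff_if rate_def neighbour_def two_channel_mean_time_def)
  then show ?thesis
    using \<open>x \<in> states\<close> by (subst sum_generator_mult) (simp_all add: states_eq del: One_nat_def)
qed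

lemma mean_time_to_3_eq:
  assumes "k > 0" "\<epsilon> > 0" "two_channel_chain k \<epsilon> M X" "(i, \<alpha>) \<in> states"
  shows "mean_time_to_3 M X i \<alpha> = ennreal (two_channel_mean_time k \<epsilon> (i, \<alpha>))"
  unfolding mean_time_to_3_def
proof (rule mean_hitting_time_eq_poisson_solution)
  show "ctmc_from (M (i, \<alpha>)) states (generator states (rate k \<epsilon>)) (i, \<alpha>) (X (i, \<alpha>))"
    using assms by (auto simp: two_channel_chain_def)
  show "finite states" by (simp add: states_eq)
  show "two_channel_mean_time k \<epsilon> x \<ge> 0" for x
    using assms by (simp add: two_channel_mean_time_def)
  show "(\<Sum>y\<in>states. generator states (rate k \<epsilon>) x y * two_channel_mean_time k \<epsilon> y) = - 1"
    if "x \<in> states - {x. fst x = 3}" for x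
    using two_channel_mean_time_poisson[OF assms(1,2)] that by auto
qed (use assms in \<open>auto simp: generator_def rate_def two_channel_mean_time_def\<close>)

theorem mainTheorem13:
  fixes k :: real
    and M :: "real \<Rightarrow> nat \<times> nat \<Rightarrow> 'w measure"
    and X :: "real \<Rightarrow> nat \<times> nat \<Rightarrow> real \<Rightarrow> 'w \<Rightarrow> nat \<times> nat"
  assumes "k > 0"
  shows "(\<forall>\<epsilon>>0. two_channel_chain k \<epsilon> (M \<epsilon>) (X \<epsilon>) \<longrightarrow>
            mean_time_to_3 (M \<epsilon>) (X \<epsilon>) 1 1 = ennreal (4 / k + 2 / \<epsilon>) \<and>
            mean_time_to_3 (M \<epsilon>) (X \<epsilon>) 1 2 = ennreal (4 / k + 2 / \<epsilon>) \<and>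
            mean_time_to_3 (M \<epsilon>) (X \<epsilon>) 2 1 = ennreal (3 / k + 2 / \<epsilon>) \<and>
            mean_time_to_3 (M \<epsilon>) (X \<epsilon>) 4 2 = ennreal (3 / k + 2 / \<epsilon>) \<and>
            mean_time_to_3 (M \<epsilon>) (X \<epsilon>) 4 1 = ennreal (3 / k) \<and>
            mean_time_to_3 (M \<epsilon>) (X \<epsilon>) 2 2 = ennreal (3 / k)) \<and>
         ((\<forall>\<epsilon>>0. two_channel_chain k \<epsilon> (M \<epsilon>) (X \<epsilon>)) \<longrightarrow>
            (\<forall>\<alpha>\<in>{1, 2}.
               (\<forall>\<epsilon>>0. mean_time_to_3 (M \<epsilon>) (X \<epsilon>) 1 \<alpha> = ennreal (4 / k + 2 / \<epsilon>)) \<and>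
               (\<lambda>\<epsilon>. enn2real (mean_time_to_3 (M \<epsilon>) (X \<epsilon>) 1 \<alpha>)) \<sim>[at_right 0] (\<lambda>\<epsilon>. 2 / \<epsilon>)))"
proof (intro conjI allI impI ballI)
  fix \<alpha> :: nat
  assume chain: "\<forall>\<epsilon>>0. two_channel_chain k \<epsilon> (M \<epsilon>) (X \<epsilon>)" and "\<alpha> \<in> {1, 2}"
  then have eq: "mean_time_to_3 (M \<epsilon>) (X \<epsilon>) 1 \<alpha> = ennreal (4 / k + 2 / \<epsilon>)" if "\<epsilon> > 0" for \<epsilon>
    using mean_time_to_3_eq[OF \<open>k > 0\<close> that, of "M \<epsilon>" "X \<epsilon>" 1 \<alpha>] that
    by (auto simp: states_eq two_channel_mean_time_def)
  then show "mean_time_to_3 (M \<epsilon>) (X \<epsilon>) 1 \<alpha> = ennreal (4 / k + 2 / \<epsilon>)" if "\<epsilon> > 0" for \<epsilon>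
    using that .
  \<comment> \<open>The values are known only for \<open>\<epsilon> > 0\<close>, which is eventually
    true in \<open>at_right 0\<close>. Removing \<open>ennreal_plus\<close> keeps the sum under one
    \<open>ennreal\<close>, so that \<open>enn2real\<close> cancels it.\<close>
  have ev: "\<forall>\<^sub>F \<epsilon> in at_right 0. 4 / k + 2 / \<epsilon> = enn2real (mean_time_to_3 (M \<epsilon>) (X \<epsilon>) 1 \<alpha>)"
    using eventually_at_right_less[of 0] by eventually_elim (use \<open>k > 0\<close> in \<open>simp add: eq del: One_nat_def ennreal_plus\<close>)
  \<comment> \<open>The quotient of the two sides is \<open>1 + 2 * \<epsilon> / k\<close>, which
    tends to 1.\<close>
  have "(\<lambda>\<epsilon>. 4 / k + 2 / \<epsilon>) \<sim>[at_right 0] (\<lambda>\<epsilon>. 2 / \<epsilon>)"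
    using \<open>k > 0\<close> by real_asymp
  then show "(\<lambda>\<epsilon>. enn2real (mean_time_to_3 (M \<epsilon>) (X \<epsilon>) 1 \<alpha>)) \<sim>[at_right 0] (\<lambda>\<epsilon>. 2 / \<epsilon>)"
    using ev by (rule asymp_equiv_transfer) simp
qed (use assms in \<open>auto simp: mean_time_to_3_eq states_eq two_channel_mean_time_def\<close>)

end
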